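(* The spaces $\gamma\mathbb{R}$ and $\beta\mathbb{R}$ are not homeomorphic.
   Context: $\mathbb{N}=\{0,1,2,\dots\}$. Let $f_0(x)=\tanh(x)$ and $f_n(x)=\cos(nx)$ for $n\ge 1$, regarded as functions $\mathbb{R}\to[-1,1]$. Let $Y=\prod_{n\in\mathbb{N}}[-1,1]$ with the product topology, and define $k:\mathbb{R}\to Y$ by $k(x)(n)=f_n(x)$. The space $\gamma\mathbb{R}$ is the closure of $k(\mathbb{R})$ in $Y$, with the subspace topology. The space $\beta\mathbb{R}$ is the Stone-Čech compactification of $\mathbb{R}$: let $\{g_\lambda:\lambda\in\Lambda\}$ be the family of all bounded continuous functions $\mathbb{R}\to\mathbb{R}$, let $I_\lambda=[\inf \operatorname{ran}(g_\lambda),\sup \operatorname{ran}(g_\lambda)]$, and define $h:\mathbb{R}\to\prod_{\lambda\in\Lambda}I_\lambda$ by $h(x)(\lambda)=g_\lambda(x)$; then $\beta\mathbb{R}$ is the closure of $h(\mathbb{R})$ in $\prod_{\lambda\in\Lambda}I_\lambda$ (product topology). *)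

theory Defs
  imports "HOL-Analysis.Analysis"
begin

text \<open>The compactification \<open>\<gamma>\<real>\<close>: the closure of the image of the real line under
  \<open>x \<mapsto> (tanh x, cos x, cos (2x), \<dots>)\<close> in a countable power of \<open>[-1, 1]\<close>.\<close>

definition gamma_f :: "nat \<Rightarrow> real \<Rightarrow> real" where
  "gamma_f n x = (if n = 0 then tanh x else cos (real n * x))"

definition gamma_cube :: "(nat \<Rightarrow> real) topology" where
  "gamma_cube = product_topology (\<lambda>n. top_of_set {-1..1}) UNIV"

definition gamma_k :: "real \<Rightarrow> nat \<Rightarrow> real" where
  "gamma_k x = (\<lambda>n. gamma_f n x)"

definition gammaR :: "(nat \<Rightarrow> real) topology" where
  "gammaR = subtopology gamma_cube (gamma_cube closure_of range gamma_k)"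

text \<open>The Stone--Cech compactification \<open>\<beta>\<real>\<close>. The family of bounded continuous functions is
  indexed by itself. Points of a library product over an index set are functions that are
  \<open>undefined\<close> off that set, hence the \<open>restrict\<close> in \<open>beta_h\<close>.\<close>

definition bounded_continuous :: "(real \<Rightarrow> real) set" where
  "bounded_continuous = {g. continuous_on UNIV g \<and> bounded (range g)}"

definition beta_cube :: "((real \<Rightarrow> real) \<Rightarrow> real) topology" where
  "beta_cube = product_topology (\<lambda>g. top_of_set {Inf (range g)..Sup (range g)}) bounded_continuous"

definition beta_h :: "real \<Rightarrow> (real \<Rightarrow> real) \<Rightarrow> real" where
  "beta_h x = restrict (\<lambda>g. g x) bounded_continuous"

definition betaR :: "((real \<Rightarrow> real) \<Rightarrow> real) topology" where
  "betaR = subtopology beta_cube (beta_cube closure_of range beta_h)"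

end

theory Submission
  imports Defs
begin

text \<open>\<open>\<gamma>\<real>\<close> is compact and metrizable, hence sequentially compact. In \<open>\<beta>\<real>\<close>, however, the
  sequence of the natural numbers has no convergent subsequence: every strictly increasing
  sequence of naturals admits a bounded continuous function that takes the value 0 at its even
  terms and 1 at its odd terms, and this function extends to a coordinate of \<open>\<beta>\<real>\<close>.\<close>

lemma compact_space_gammaR: "compact_space gammaR"
  unfolding gammaR_def gamma_cube_def
  by (intro compact_space_subtopology closedin_compact_space closedin_closure_of)
     (simp add: compact_space_product_topology compact_space_subtopology)

text \<open>Countability of the index type \<open>nat\<close> is decisive: a countable product of
  metrizable spaces is metrizable.\<close>

lemma metrizable_space_gammaR: "metrizable_space gammaR"
  unfolding gammaR_def gamma_cube_def
  by (intro metrizable_space_subtopology)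
     (simp add: metrizable_space_product_topology metrizable_space_subtopology
        metrizable_space_euclidean)

lemma range_beta_h_subset: "range beta_h \<subseteq> topspace betaR"
proof -
  have "g x \<in> {Inf (range g)..Sup (range g)}" if "g \<in> bounded_continuous" for g x
    using that bounded_imp_bdd_above bounded_imp_bdd_below
    by (auto simp: bounded_continuous_def intro: cInf_lower cSup_upper)
  then have "range beta_h \<subseteq> topspace beta_cube"
    by (auto simp: beta_cube_def beta_h_def)
  then show ?thesis
    by (simp add: betaR_def closure_of_subset)
qed

text \<open>Convergence in a product is coordinatewise, and the coordinate of
  \<open>beta_h x\<close> at \<open>g\<close> is \<open>g x\<close>.\<close>

lemma limitin_betaR_imp_convergent:
  assumes lim: "limitin betaR (\<lambda>n. beta_h (x n)) l sequentially" and g: "g \<in> bounded_continuous"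
  shows "convergent (\<lambda>n. g (x n))"
proof -
  have "limitin (top_of_set {Inf (range g)..Sup (range g)}) (\<lambda>n. beta_h (x n) g) (l g) sequentially"
    using lim g by (simp add: betaR_def beta_cube_def limitin_subtopology limitin_componentwise)
  then show ?thesis
    using g by (auto simp: limitin_subtopology beta_h_def convergent_def)
qed

lemma bounded_continuous_alternating_on_subsequence:
  fixes r :: "nat \<Rightarrow> nat"
  assumes r: "strict_mono r"
  obtains g where "g \<in> bounded_continuous"
    "\<And>n. g (real (r (2 * n))) = 0" "\<And>n. g (real (r (2 * n + 1))) = 1"
proof
  define A where "A = range (\<lambda>n. real (r (2 * n)))"
  \<comment> \<open>Truncation at 1 makes the distance function bounded and gives exactly 1 wherever
    the distance to \<open>A\<close> is at least 1.\<close>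
  define g where "g = (\<lambda>x. min 1 (infdist x A))"
  have "continuous_on UNIV g"
    unfolding g_def by (intro continuous_intros)
  moreover have "bounded (range g)"
    by (rule boundedI[where B = 1]) (auto simp: g_def infdist_nonneg)
  ultimately show "g \<in> bounded_continuous"
    by (simp add: bounded_continuous_def)
  show "g (real (r (2 * n))) = 0" for n
    by (simp add: g_def A_def)
  show "g (real (r (2 * n + 1))) = 1" for n
  proof -
    have "1 \<le> dist (real (r (2 * n + 1))) a" if a: "a \<in> A" for a
    proof -
      obtain m where m: "a = real (r (2 * m))"
        using a by (auto simp: A_def)
      have "2 * n + 1 \<noteq> 2 * m"
        by presburger
      then have "r (2 * n + 1) \<noteq> r (2 * m)"
        using strict_mono_eq[OF r] by blast
      \<comment> \<open>Distinct naturals are at distance at least 1.\<close>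
      then show ?thesis
        unfolding m dist_real_def by linarith
    qed
    \<comment> \<open>Since \<open>A\<close> is nonempty, \<open>infdist\<close> is a genuine
      infimum here, not its default value 0, so the lower bound passes to it.\<close>
    then have "1 \<le> infdist (real (r (2 * n + 1))) A"
      by (auto simp: infdist_def A_def intro!: cINF_greatest)
    then show ?thesis
      by (simp add: g_def)
  qed
qed

lemma no_convergent_subsequence_betaR:
  assumes r: "strict_mono r"
  shows "\<not> limitin betaR (\<lambda>n. beta_h (real (r n))) l sequentially"
proof
  assume lim: "limitin betaR (\<lambda>n. beta_h (real (r n))) l sequentially"
  obtain g where g: "g \<in> bounded_continuous"
    and g0: "\<And>n. g (real (r (2 * n))) = 0" and g1: "\<And>n. g (real (r (2 * n + 1))) = 1"
    using bounded_continuous_alternating_on_subsequence[OF r] by blast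
  obtain c where c: "(\<lambda>n. g (real (r n))) \<longlonglongrightarrow> c"
    using limitin_betaR_imp_convergent[OF lim g] by (auto simp: convergent_def)
  \<comment> \<open>Both are subsequences of one convergent sequence, so they share the limit
    \<open>c\<close>.\<close>
  have "(\<lambda>n. g (real (r (2 * n)))) \<longlonglongrightarrow> c" "(\<lambda>n. g (real (r (2 * n + 1)))) \<longlonglongrightarrow> c"
    using LIMSEQ_subseq_LIMSEQ[OF c, of "\<lambda>n. 2 * n"]
      LIMSEQ_subseq_LIMSEQ[OF c, of "\<lambda>n. 2 * n + 1"]
    by (simp_all add: strict_mono_def o_def)
  then have "c = 0" "c = 1"
    unfolding g0 g1 by (auto simp: LIMSEQ_const_iff)
  then show False
    by simp
qed

theorem corollary3p7:
  shows "\<not> gammaR homeomorphic_space betaR"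
proof
  assume "gammaR homeomorphic_space betaR"
  then have compact: "compact_space betaR" and "metrizable_space betaR"
    using compact_space_gammaR metrizable_space_gammaR homeomorphic_compact_space
      homeomorphic_metrizable_space by blast+
  \<comment> \<open>Compactness and metrizability have passed through the homeomorphism, so a metric
    can be fixed on \<open>betaR\<close> itself and sequential compactness applied there.\<close>
  then obtain M d where "Metric_space M d" and mtop: "betaR = Metric_space.mtopology M d"
    by (auto simp: metrizable_space_def)
  then interpret Metric_space M d
    by simp
  have "range (\<lambda>n. beta_h (real n)) \<subseteq> M"
    using range_beta_h_subset unfolding mtop topspace_mtopology by blast
  moreover have "compact_space mtopology"
    using compact mtop by simp
  ultimately obtain l r where "strict_mono r"
    "limitin mtopology ((\<lambda>n. beta_h (real n)) \<circ> r) l sequentially"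
    unfolding compact_space_sequentially by blast
  then show False
    using no_convergent_subsequence_betaR[of r l] by (simp add: mtop o_def)
qed

end
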